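(* Let $\epsilon,\delta>0$, let $P_0,P_1$ be distributions with $A_\delta<\infty$, let $j\in\{1,\dots,n\}$, let $i,i'\in\{0,1\}$, and let $x_1,\dots,x_{j-1},x_{j+1},\dots,x_n\in\mathbb{R}$ be arbitrary fixed values. Let $X_i=\{x_1,\dots,x_n\}$ denote the random database with $x_j\sim P_i$, and let $X'_{i'}=\{x_1,\dots,x_{j-1},x'_j,x_{j+1},\dots,x_n\}$ denote the random database with $x'_j\sim P_{i'}$. Then for any $S\subseteq\{1,\dots,n\}$, $$\Pr[\mathrm{OfflinePCPD}(X_i,P_0,P_1,\epsilon,\delta,n)\in S]\le \exp(\epsilon)\cdot\Pr[\mathrm{OfflinePCPD}(X'_{i'},P_0,P_1,\epsilon,\delta,n)\in S]+\delta,$$ where the probabilities are over the randomness of the algorithm and of $X_i,X'_{i'}$.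
   Context: $P_0,P_1$ are probability distributions on $\mathbb{R}$, and $P_0(x),P_1(x)$ denote their densities (or mass functions) with respect to a common reference measure. $\log$ is the natural logarithm, with the convention $\log\frac00=0$. For a database $X=\{x_1,\dots,x_n\}$ (an ordered list of $n$ reals) and $k\in\{1,\dots,n\}$, set $\ell(k)=\sum_{m=k}^n\log\frac{P_1(x_m)}{P_0(x_m)}$. For $\delta>0$, $$A_\delta=\min\left\{t:\ \max_{i=0,1}\Pr_{x\sim P_i}\left[2\left|\log\frac{P_1(x)}{P_0(x)}\right|>t\right]<\delta/2\right\}$$ (min is read as infimum if not attained; $A_\delta<\infty$ means that the set is nonempty). $\mathrm{Lap}(b)$ is the Laplace distribution with density $\frac1{2b}e^{-|x|/b}$ (for $b=0$, the point mass at $0$). Algorithm $\mathrm{OfflinePCPD}(X,P_0,P_1,\epsilon,\delta,n)$ for $\delta>0$: let $A=A_\delta$; draw $Z_1,\dots,Z_n$ i.i.d. from $\mathrm{Lap}(A/\epsilon)$, independent of $X$; output $\tilde k=\mathrm{argmax}_{1\le k\le n}\{\ell(k)+Z_k\}$ (ties, if any, broken by a fixed rule). *)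

theory Defs
  imports "HOL-Probability.Probability"
begin

text \<open>
  The two hypotheses are indexed by \<open>0\<close> and \<open>1\<close>: \<open>P i\<close> is a distribution on the reals and \<open>p i\<close> a
  version of its density with respect to a common reference measure.
  The logarithmic ratio takes values in \<^typ>\<open>ereal\<close> because a single density may vanish at a point;
  the first case is the convention that the logarithm of \<open>0/0\<close> is \<open>0\<close>.
\<close>

definition log_ratio :: "(nat \<Rightarrow> real \<Rightarrow> real) \<Rightarrow> real \<Rightarrow> ereal" where
  "log_ratio p y =
    (if p 0 y = 0 \<and> p 1 y = 0 then 0
     else if p 0 y = 0 then \<infinity>
     else if p 1 y = 0 then -\<infinity>
     else ereal (ln (p 1 y / p 0 y)))"

text \<open>
  Databases are functions of which only the entries \<open>1, \<dots>, n\<close> matter.  The sum is the one of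
  \<^typ>\<open>ereal\<close>, where \<open>\<infinity> + (-\<infinity>) = \<infinity>\<close>.
\<close>

definition log_lik :: "(nat \<Rightarrow> real \<Rightarrow> real) \<Rightarrow> nat \<Rightarrow> (nat \<Rightarrow> real) \<Rightarrow> nat \<Rightarrow> ereal" where
  "log_lik p n x k = (\<Sum>m = k..n. log_ratio p (x m))"

text \<open>
  The threshold serves as a Laplace scale, so only \<open>t \<ge> 0\<close> is considered.  A negative \<open>t\<close> gives
  probability \<open>1\<close>, so the restriction matters only for \<open>\<delta> > 2\<close>, where all reals would
  qualify.  The set may be empty, and only for a nonempty set is the infimum meaningful.
\<close>

definition thresholds :: "(nat \<Rightarrow> real measure) \<Rightarrow> (nat \<Rightarrow> real \<Rightarrow> real) \<Rightarrow> real \<Rightarrow> real set" where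
  "thresholds P p \<delta> =
    {t. 0 \<le> t \<and>
        (MAX i\<in>{0,1}. measure (P i) {y \<in> space (P i). ereal t < 2 * \<bar>log_ratio p y\<bar>}) < \<delta> / 2}"

definition threshold :: "(nat \<Rightarrow> real measure) \<Rightarrow> (nat \<Rightarrow> real \<Rightarrow> real) \<Rightarrow> real \<Rightarrow> real" where
  "threshold P p \<delta> = Inf (thresholds P p \<delta>)"

definition Lap :: "real \<Rightarrow> real measure" where
  "Lap b =
    (if b = 0 then return borel 0
     else density lborel (\<lambda>z. ennreal (1 / (2 * b) * exp (- \<bar>z\<bar> / b))))"

text \<open>
  The output distribution on a fixed database.  The argument \<open>tie\<close> is the tie-breaking rule: it
  selects an element of the set of all maximisers.
\<close>

definition OfflinePCPD ::
  "(nat set \<Rightarrow> nat) \<Rightarrow> (nat \<Rightarrow> real) \<Rightarrow> (nat \<Rightarrow> real measure) \<Rightarrow> (nat \<Rightarrow> real \<Rightarrow> real)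
    \<Rightarrow> real \<Rightarrow> real \<Rightarrow> nat \<Rightarrow> nat measure" where
  "OfflinePCPD tie x P p \<epsilon> \<delta> n =
    distr (\<Pi>\<^sub>M k\<in>{1..n}. Lap (threshold P p \<delta> / \<epsilon>)) (count_space UNIV)
      (\<lambda>Z. tie {k. is_arg_max (\<lambda>k. log_lik p n x k + ereal (Z k)) (\<lambda>k. k \<in> {1..n}) k})"

end

theory Submission
  imports Defs
begin

text \<open>
  Call a value \<open>y\<close> of the \<open>j\<close>-th entry good if twice the absolute log-ratio at \<open>y\<close> is at most the
  threshold \<open>A\<close>; bad values have probability at most \<open>\<delta> / 2\<close> under both hypotheses.  Exchanging one
  good value for another moves all scores with index \<open>k \<le> j\<close> by the same amount \<open>d\<close>, with \<open>\<bar>d\<bar> \<le> A\<close>,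
  and leaves the other scores alone.  An index that wins before the exchange therefore still wins
  after it if its own noise is raised by \<open>A\<close>, which costs a factor \<open>exp \<epsilon>\<close> in the density of
  \<open>Lap (A / \<epsilon>)\<close>.  Infinite scores caused by the other entries either decide the set of maximisers
  whatever the noise, or only exclude indices from winning.
\<close>

section \<open>The Laplace distribution and shifts of one noise coordinate\<close>

lemma sets_Lap [simp, measurable_cong]: "sets (Lap b) = sets borel"
  by (simp add: Lap_def)

lemma space_Lap [simp]: "space (Lap b) = UNIV"
  by (simp add: Lap_def)

text \<open>The density is the average of an exponential density of rate \<open>1 / b\<close> and
  its reflection at 0, each of mass 1.\<close>

lemma prob_space_Lap:
  assumes "b \<ge> 0"
  shows "prob_space (Lap b)"
proof (cases "b = 0")
  case True
  then show ?thesis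
    by (simp add: Lap_def prob_space_return)
next
  case False
  with assms have b: "b > 0" by simp
  let ?e = "\<lambda>z. ennreal (exponential_density (1 / b) z)"
  have e1: "(\<integral>\<^sup>+z. ?e z \<partial>lborel) = 1"
    using prob_space.emeasure_space_1[OF prob_space_exponential_density[of "1 / b"]] b
    by (simp add: emeasure_density)
  have e2: "(\<integral>\<^sup>+z. ?e (- z) \<partial>lborel) = 1"
    using e1 nn_integral_real_affine[of ?e "-1" 0] by simp
  \<comment> \<open>At 0 both exponential densities are positive, so the identity of densities fails
    there.\<close>
  have "AE z in lborel. z \<noteq> (0::real)"
    by (rule AE_lborel_singleton)
  then have "AE z in lborel. ennreal (1 / (2 * b) * exp (- \<bar>z\<bar> / b))
      = ennreal (1 / 2) * (?e z + ?e (- z))"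
  proof eventually_elim
    case (elim z)
    then have "?e z + ?e (- z) = ennreal (1 / b * exp (- \<bar>z\<bar> / b))"
      using b by (auto simp: exponential_density_def abs_if)
    then show ?case
      using b by (simp only:) (subst ennreal_mult'[symmetric], simp_all add: mult.commute)
  qed
  then have "(\<integral>\<^sup>+z. ennreal (1 / (2 * b) * exp (- \<bar>z\<bar> / b)) \<partial>lborel)
      = (\<integral>\<^sup>+z. ennreal (1 / 2) * (?e z + ?e (- z)) \<partial>lborel)"
    by (rule nn_integral_cong_AE)
  also have "\<dots> = ennreal (1 / 2) * (1 + 1)"
    by (simp add: nn_integral_cmult nn_integral_add e1 e2)
  also have "\<dots> = ennreal (1 / 2) * ennreal 2"
    by simp
  also have "\<dots> = 1"
    by (subst ennreal_mult'[symmetric]) simp_all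
  finally show ?thesis
    using b by (intro prob_spaceI) (simp add: Lap_def emeasure_density)
qed

text \<open>By the triangle inequality, translation by \<open>d\<close> changes the density by a
  factor of at most \<open>exp (\<bar>d\<bar> / b)\<close>; translation invariance of Lebesgue
  measure does the rest. The comparison of \<open>f\<close> and \<open>g\<close> is asked for only
  almost everywhere, because ties will have to be excluded.\<close>

lemma nn_integral_Lap_shift_le:
  assumes b: "b > 0" and [measurable]: "f \<in> borel_measurable borel" "g \<in> borel_measurable borel"
    and le: "AE z in lborel. f z \<le> g (z + d)"
  shows "(\<integral>\<^sup>+z. f z \<partial>Lap b) \<le> ennreal (exp (\<bar>d\<bar> / b)) * (\<integral>\<^sup>+z. g z \<partial>Lap b)"
proof -
  let ?h = "\<lambda>z. ennreal (1 / (2 * b) * exp (- \<bar>z\<bar> / b))"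
  have h: "?h z \<le> ennreal (exp (\<bar>d\<bar> / b)) * ?h (z + d)" for z
  proof -
    have "exp (- \<bar>z\<bar> / b) \<le> exp (\<bar>d\<bar> / b + - \<bar>z + d\<bar> / b)"
      using b by (simp add: field_simps)
    then have "1 / (2 * b) * exp (- \<bar>z\<bar> / b)
        \<le> 1 / (2 * b) * (exp (\<bar>d\<bar> / b) * exp (- \<bar>z + d\<bar> / b))"
      using b unfolding exp_add by (intro mult_left_mono) simp_all
    then show ?thesis
      using b by (subst ennreal_mult'[symmetric]) (auto intro!: ennreal_leI simp: mult_ac)
  qed
  have "(\<integral>\<^sup>+z. f z \<partial>Lap b) = (\<integral>\<^sup>+z. ?h z * f z \<partial>lborel)"
    using b by (simp add: Lap_def nn_integral_density)
  also have "\<dots> \<le> (\<integral>\<^sup>+z. ennreal (exp (\<bar>d\<bar> / b)) * (?h (d + 1 * z) * g (d + 1 * z)) \<partial>lborel)"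
  proof (rule nn_integral_mono_AE)
    show "AE z in lborel. ?h z * f z \<le> ennreal (exp (\<bar>d\<bar> / b)) * (?h (d + 1 * z) * g (d + 1 * z))"
      using le
    proof eventually_elim
      case (elim z)
      from mult_mono[OF h[of z] this] show ?case
        by (simp add: add.commute mult.assoc)
    qed
  qed
  also have "\<dots> = ennreal (exp (\<bar>d\<bar> / b)) * (\<integral>\<^sup>+z. ?h (d + 1 * z) * g (d + 1 * z) \<partial>lborel)"
    by (rule nn_integral_cmult) measurable
  also have "(\<integral>\<^sup>+z. ?h (d + 1 * z) * g (d + 1 * z) \<partial>lborel) = (\<integral>\<^sup>+z. ?h z * g z \<partial>lborel)"
    using nn_integral_real_affine[of "\<lambda>z. ?h z * g z" 1 d] by simp
  also have "\<dots> = (\<integral>\<^sup>+z. g z \<partial>Lap b)"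
    using b by (simp add: Lap_def nn_integral_density)
  finally show ?thesis .
qed

text \<open>Fubini: the other coordinates are frozen at \<open>w\<close>, and the one-dimensional
  bound is applied to the coordinate \<open>k\<close>. The exceptional null set may therefore depend
  on \<open>w\<close>.\<close>

lemma emeasure_PiM_Lap_shift_le:
  assumes b: "b > 0" and I: "finite I" "k \<in> I"
    and B [measurable]: "B \<in> sets (\<Pi>\<^sub>M k\<in>I. Lap b)" "B' \<in> sets (\<Pi>\<^sub>M k\<in>I. Lap b)"
    and le: "\<And>w. AE z in lborel. w(k := z) \<in> B \<longrightarrow> w(k := z + d) \<in> B'"
  shows "emeasure (\<Pi>\<^sub>M k\<in>I. Lap b) B \<le> ennreal (exp (\<bar>d\<bar> / b)) * emeasure (\<Pi>\<^sub>M k\<in>I. Lap b) B'"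
proof -
  interpret L: prob_space "Lap b" using b by (intro prob_space_Lap) simp
  interpret product_sigma_finite "\<lambda>_. Lap b" by standard
  let ?J = "I - {k}"
  have J: "insert k ?J = I" "finite ?J" "k \<notin> ?J" using I by auto
  have fub: "emeasure (PiM I (\<lambda>_. Lap b)) C
      = (\<integral>\<^sup>+w. \<integral>\<^sup>+z. indicator C (w(k := z)) \<partial>Lap b \<partial>PiM ?J (\<lambda>_. Lap b))"
    if [measurable]: "C \<in> sets (PiM I (\<lambda>_. Lap b))" for C
    using product_nn_integral_insert[OF J(2,3), of "indicator C"] that
    unfolding J(1) by simp
  have meas: "(\<lambda>z. indicator C (w(k := z)) :: ennreal) \<in> borel_measurable borel"
    if [measurable]: "C \<in> sets (PiM I (\<lambda>_. Lap b))" and w: "w \<in> space (PiM ?J (\<lambda>_. Lap b))" for C w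
  proof -
    have "(\<lambda>z. w(k := z)) \<in> measurable (Lap b) (PiM I (\<lambda>_. Lap b))"
      using measurable_component_update[OF w J(3)] J(1) by simp
    then have [measurable]: "(\<lambda>z. w(k := z)) \<in> measurable borel (PiM I (\<lambda>_. Lap b))"
      by (simp cong: measurable_cong_sets)
    show ?thesis by measurable
  qed
  have "emeasure (PiM I (\<lambda>_. Lap b)) B
      \<le> (\<integral>\<^sup>+w. ennreal (exp (\<bar>d\<bar> / b)) * (\<integral>\<^sup>+z. indicator B' (w(k := z)) \<partial>Lap b) \<partial>PiM ?J (\<lambda>_. Lap b))"
    unfolding fub[OF B(1)]
  proof (intro nn_integral_mono nn_integral_Lap_shift_le b meas B)
    fix w
    show "AE z in lborel. indicator B (w(k := z)) \<le> (indicator B' (w(k := z + d)) :: ennreal)"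
      using le[of w] by eventually_elim (auto simp: indicator_def)
  qed
  also have "\<dots> = ennreal (exp (\<bar>d\<bar> / b)) * emeasure (PiM I (\<lambda>_. Lap b)) B'"
    unfolding fub[OF B(2)]
  proof (rule nn_integral_cmult)
    have [measurable]: "(\<lambda>(w, z). w(k := z)) \<in>
        measurable (PiM ?J (\<lambda>_. Lap b) \<Otimes>\<^sub>M Lap b) (PiM I (\<lambda>_. Lap b))"
      using measurable_add_dim[of k ?J "\<lambda>_. Lap b"] by (simp only: J(1))
    show "(\<lambda>w. \<integral>\<^sup>+z. indicator B' (w(k := z)) \<partial>Lap b) \<in> borel_measurable (PiM ?J (\<lambda>_. Lap b))"
      by measurable
  qed
  finally show ?thesis .
qed

section \<open>Sets of maximisers\<close>

definition maximisers :: "nat set \<Rightarrow> (nat \<Rightarrow> ereal) \<Rightarrow> nat set" where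
  "maximisers I s = {k. is_arg_max s (\<lambda>k. k \<in> I) k}"

lemma mem_maximisers: "k \<in> maximisers I s \<longleftrightarrow> k \<in> I \<and> (\<forall>l\<in>I. s l \<le> s k)"
  by (auto simp: maximisers_def is_arg_max_def not_less)

lemma maximisers_nonempty:
  assumes "finite I" "I \<noteq> {}"
  shows "maximisers I s \<noteq> {}"
proof -
  have "Max (s ` I) \<in> s ` I"
    using assms by (intro Max_in) auto
  then obtain k where "k \<in> I" "s k = Max (s ` I)"
    by (metis imageE)
  then have "k \<in> maximisers I s"
    using assms by (simp add: mem_maximisers)
  then show ?thesis by auto
qed

text \<open>Only the lead of \<open>k\<close> over each \<open>l\<close> matters, and no lead
  shrinks; infinite values of \<open>u\<close> absorb the real summands.\<close>

lemma maximisers_shift: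
  assumes "k \<in> maximisers I (\<lambda>k. u k + ereal (v k))"
    and "\<And>l. l \<in> I \<Longrightarrow> v k - v l \<le> v' k - v' l"
  shows "k \<in> maximisers I (\<lambda>k. u k + ereal (v' k))"
  unfolding mem_maximisers
proof safe
  show "k \<in> I" using assms(1) by (simp add: mem_maximisers)
  fix l assume l: "l \<in> I"
  with assms(1) have "u l + ereal (v l) \<le> u k + ereal (v k)"
    by (simp add: mem_maximisers)
  with assms(2)[OF l] show "u l + ereal (v' l) \<le> u k + ereal (v' k)"
    by (cases "u l"; cases "u k") auto
qed

text \<open>Real noise cannot change an infinite score: the indices at \<open>\<infinity>\<close>
  are exactly the maximisers if there are any, and if every score is \<open>-\<infinity>\<close> all
  indices tie.\<close>

lemma maximisers_degenerate:
  assumes "(\<exists>k\<in>I. u k = \<infinity>) \<or> (\<forall>k\<in>I. u k = -\<infinity>)"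
  shows "maximisers I (\<lambda>k. u k + ereal (v k)) = maximisers I (\<lambda>k. u k + ereal (v' k))"
proof -
  have eq: "maximisers I (\<lambda>k. u k + ereal (v k)) = {k\<in>I. u k = \<infinity> \<or> (\<forall>l\<in>I. u l = -\<infinity>)}" for v
  proof (cases "\<exists>k\<in>I. u k = \<infinity>")
    case True
    then obtain k0 where k0: "k0 \<in> I" "u k0 = \<infinity>" by auto
    then show ?thesis by (force simp: mem_maximisers)
  next
    case False
    with assms show ?thesis by (auto simp: mem_maximisers)
  qed
  show ?thesis unfolding eq ..
qed

text \<open>There are only finitely many possible sets, each singled out by finitely many
  comparisons of measurable scores.\<close>

lemma measurable_maximisers:
  assumes I: "finite I"
    and [measurable]: "\<And>k. k \<in> I \<Longrightarrow> s k \<in> borel_measurable M"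
  shows "(\<lambda>x. maximisers I (\<lambda>k. s k x)) \<in> measurable M (count_space (Pow I))"
proof -
  note [simp] = I
  have "(\<lambda>x. maximisers I (\<lambda>k. s k x)) -` {K} \<inter> space M \<in> sets M" if K: "K \<subseteq> I" for K
  proof -
    have "(\<lambda>x. maximisers I (\<lambda>k. s k x)) -` {K} \<inter> space M =
        {x\<in>space M. \<forall>k\<in>I. (k \<in> K) = (\<forall>l\<in>I. s l x \<le> s k x)}"
      using K by (auto simp: set_eq_iff mem_maximisers)
    also have "\<dots> \<in> sets M"
      using I by (intro sets.sets_Collect_finite_All) measurable
    finally show ?thesis .
  qed
  then show ?thesis
    using I by (subst measurable_count_space_eq_countable)
      (auto simp: mem_maximisers countable_finite)
qed

text \<open>The sets of maximisers range over a discrete space, on which every tie-breaking rule is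
  measurable.\<close>

lemma measurable_tie_maximisers:
  assumes I: "finite I" and s: "\<And>k. k \<in> I \<Longrightarrow> s k \<in> borel_measurable M"
  shows "(\<lambda>x. tie (maximisers I (\<lambda>k. s k x))) \<in> measurable M (count_space UNIV)"
proof -
  have "(\<lambda>x. maximisers I (\<lambda>k. s k x)) \<in> measurable M (count_space (Pow I))"
    by (rule measurable_maximisers[OF I s])
  then show ?thesis
    by (rule measurable_compose) (rule measurable_count_space)
qed

section \<open>Probability of one winner under changed scores\<close>

text \<open>Raising the noise of \<open>k\<close> by \<open>d\<close> makes up for the largest loss
  of \<open>k\<close> against any rival when \<open>g\<close> is replaced by \<open>g'\<close>.
  Outside finitely many values of that noise the new maximiser is unique, so the rule must return
  \<open>k\<close>, however it behaves on ties.\<close>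

lemma noisy_maximiser_shift_le:
  fixes u :: "nat \<Rightarrow> ereal" and g g' :: "nat \<Rightarrow> real" and tie :: "nat set \<Rightarrow> nat"
  assumes b: "b > 0" and I: "finite I" "k \<in> I"
    and tie: "\<And>K. K \<noteq> {} \<Longrightarrow> K \<subseteq> I \<Longrightarrow> tie K \<in> K"
    and u: "\<And>l. l \<in> I \<Longrightarrow> u l \<noteq> \<infinity>" "\<exists>l\<in>I. u l \<noteq> -\<infinity>"
    and d: "\<And>l. l \<in> I \<Longrightarrow> (g k - g l) - (g' k - g' l) \<le> d"
  defines "M \<equiv> \<Pi>\<^sub>M k\<in>I. Lap b"
  shows "emeasure M {Z\<in>space M. tie (maximisers I (\<lambda>l. u l + ereal (g l + Z l))) = k}
    \<le> ennreal (exp (d / b)) * emeasure M {Z\<in>space M. tie (maximisers I (\<lambda>l. u l + ereal (g' l + Z l))) = k}"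
    (is "emeasure M ?B \<le> _ * emeasure M ?B'")
proof -
  \<comment> \<open>This is the case \<open>l = k\<close> of the hypothesis; it gives
    \<open>\<bar>d\<bar> = d\<close> in the shift bound.\<close>
  from d[OF I(2)] have d0: "0 \<le> d" by simp
  have sets: "{Z\<in>space M. tie (maximisers I (\<lambda>l. u l + ereal (h l + Z l))) = k} \<in> sets M" for h
  proof -
    have [measurable]: "(\<lambda>Z. tie (maximisers I (\<lambda>l. u l + ereal (h l + Z l)))) \<in> measurable M (count_space UNIV)"
      unfolding M_def by (intro measurable_tie_maximisers I) measurable
    show ?thesis by measurable
  qed
  have "emeasure M ?B \<le> ennreal (exp (\<bar>d\<bar> / b)) * emeasure M ?B'"
    unfolding M_def
  proof (rule emeasure_PiM_Lap_shift_le[OF b I sets[unfolded M_def] sets[unfolded M_def]])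
    fix w :: "nat \<Rightarrow> real"
    \<comment> \<open>the values of the \<open>k\<close>-th noise for which \<open>k\<close> is tied after the shift\<close>
    let ?T = "(\<lambda>l. real_of_ereal (u l) + (g' l + w l) - real_of_ereal (u k) - g' k - d) ` I"
    have "AE z in lborel. z \<notin> ?T"
      using I by (intro AE_not_in finite_imp_null_set_lborel) simp
    then show "AE z in lborel. w(k := z) \<in> {Z \<in> space (Pi\<^sub>M I (\<lambda>k. Lap b)).
          tie (maximisers I (\<lambda>l. u l + ereal (g l + Z l))) = k} \<longrightarrow>
        w(k := z + d) \<in> {Z \<in> space (Pi\<^sub>M I (\<lambda>k. Lap b)).
          tie (maximisers I (\<lambda>l. u l + ereal (g' l + Z l))) = k}"
    proof (eventually_elim, intro impI)
      fix z assume z: "z \<notin> ?T"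
      let ?Z = "w(k := z)" and ?Z' = "w(k := z + d)"
      let ?K = "maximisers I (\<lambda>l. u l + ereal (g l + ?Z l))"
      let ?K' = "maximisers I (\<lambda>l. u l + ereal (g' l + ?Z' l))"
      assume Z: "?Z \<in> {Z \<in> space (Pi\<^sub>M I (\<lambda>k. Lap b)).
          tie (maximisers I (\<lambda>l. u l + ereal (g l + Z l))) = k}"
      then have sp: "?Z' \<in> space (Pi\<^sub>M I (\<lambda>k. Lap b))"
        using I by (auto simp: space_PiM PiE_def extensional_def split: if_splits)
      have "tie ?K \<in> ?K"
        using I by (intro tie maximisers_nonempty) (auto simp: mem_maximisers)
      with Z have k: "k \<in> ?K" by simp
      then have k': "k \<in> ?K'"
      proof (rule maximisers_shift)
        fix l assume "l \<in> I"
        with d[OF this] show "g k + ?Z k - (g l + ?Z l) \<le> g' k + ?Z' k - (g' l + ?Z' l)"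
          by auto
      qed
      \<comment> \<open>Some index has a score above \<open>-\<infinity>\<close> and does not beat
        \<open>k\<close>, so \<open>u k\<close> is finite; a tie with \<open>k\<close> then becomes
        an equation between reals.\<close>
      have uk: "\<bar>u k\<bar> \<noteq> \<infinity>"
      proof -
        obtain l where l: "l \<in> I" "u l \<noteq> -\<infinity>" using u(2) by auto
        with k have "u l + ereal (g l + ?Z l) \<le> u k + ereal (g k + ?Z k)"
          unfolding mem_maximisers by blast
        with l u(1)[OF I(2)] show ?thesis by (cases "u l"; cases "u k") auto
      qed
      \<comment> \<open>Keeping \<open>k\<close> among the maximisers would not suffice: from a
        different set the rule may choose a different element.\<close>
      have "l = k" if l: "l \<in> ?K'" for l
      proof (rule ccontr)
        assume "l \<noteq> k"
        from l have "l \<in> I" by (simp add: mem_maximisers)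
        from l k' have "u l + ereal (g' l + ?Z' l) = u k + ereal (g' k + ?Z' k)"
          unfolding mem_maximisers by (blast intro: antisym)
        with uk \<open>l \<noteq> k\<close>
        have "z = real_of_ereal (u l) + (g' l + w l) - real_of_ereal (u k) - g' k - d"
          by (cases "u l"; cases "u k") auto
        with z \<open>l \<in> I\<close> show False by blast
      qed
      with k' have "?K' = {k}" by auto
      moreover have "tie {k} = k"
        using tie[of "{k}"] I by simp
      ultimately show "?Z' \<in> {Z \<in> space (Pi\<^sub>M I (\<lambda>k. Lap b)).
          tie (maximisers I (\<lambda>l. u l + ereal (g' l + Z l))) = k}"
        using sp by simp
    qed
  qed
  with d0 show ?thesis by simp
qed

section \<open>From good values to random entries\<close>

text \<open>Since any two good values can be compared, a single constant fits between
  \<open>q\<close> and \<open>e * q\<close> on \<open>G\<close>, and \<open>M\<close> and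
  \<open>N\<close> may be unrelated. Each of the two comparisons with the constant loses at most
  \<open>\<delta> / 2\<close> on the bad set.\<close>

lemma integral_le_if_ratio_bounded_on_good:
  fixes q :: "real \<Rightarrow> real" and M N :: "real measure"
  assumes "prob_space M" "prob_space N" and s: "sets M = sets borel" "sets N = sets borel"
    and q [measurable]: "q \<in> borel_measurable borel" and q01: "\<And>y. 0 \<le> q y" "\<And>y. q y \<le> 1"
    and G [measurable]: "G \<in> sets borel"
    and bad: "measure M (- G) \<le> \<delta> / 2" "measure N (- G) \<le> \<delta> / 2"
    and good: "\<And>y y'. y \<in> G \<Longrightarrow> y' \<in> G \<Longrightarrow> q y \<le> e * q y'" and e: "e > 0"
  shows "(\<integral>y. q y \<partial>M) \<le> e * (\<integral>y. q y \<partial>N) + \<delta>"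
proof -
  interpret M: prob_space M by fact
  interpret N: prob_space N by fact
  note [measurable_cong] = s
  have sp: "space M = UNIV" "space N = UNIV"
    using s[THEN sets_eq_imp_space_eq] by simp_all
  have int: "integrable M q" "integrable N q"
    using q01 by (auto intro!: M.integrable_const_bound[of _ 1] N.integrable_const_bound[of _ 1])
  \<comment> \<open>\<open>q \<le> c \<le> e * q\<close> on \<open>G\<close>, so both integrals can be compared with the constant \<open>c\<close>; \<open>c \<le> 1\<close> keeps
    the loss on \<open>- G\<close> down to its measure\<close>
  define c where "c = (if G = {} then 0 else min 1 (e * Inf (q ` G)))"
  have bdd: "bdd_below (q ` G)" using q01 by (auto intro!: bdd_belowI[of _ 0])
  have c01: "0 \<le> c" "c \<le> 1"
    using e q01 by (auto simp: c_def intro!: mult_nonneg_nonneg cINF_greatest)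
  have upper: "q y \<le> c" if y: "y \<in> G" for y
  proof -
    \<comment> \<open>The value \<open>q y / e\<close> is a lower bound for \<open>q\<close> on
      \<open>G\<close>, because \<open>y\<close> is compared with every good value.\<close>
    have "q y / e \<le> Inf (q ` G)"
      using y good[OF y] e by (intro cINF_greatest) (auto simp: field_simps)
    then show ?thesis
      using y e q01 by (auto simp: c_def field_simps)
  qed
  have lower: "c \<le> e * q y" if y: "y \<in> G" for y
  proof -
    have "Inf (q ` G) \<le> q y" using y bdd by (intro cINF_lower)
    then have "e * Inf (q ` G) \<le> e * q y" using e by simp
    then show ?thesis using y by (auto simp: c_def)
  qed
  have "(\<integral>y. q y \<partial>M) \<le> (\<integral>y. c + indicator (- G) y \<partial>M)"
  proof (intro integral_mono int)
    show "integrable M (\<lambda>y. c + indicator (- G) y)"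
      by (intro Bochner_Integration.integrable_add integrable_real_indicator) (auto simp: s M.emeasure_finite less_top[symmetric])
    show "q y \<le> c + indicator (- G) y" for y
      using c01 q01(2)[of y] upper[of y] by (cases "y \<in> G") auto
  qed
  also have "\<dots> = c + measure M (- G)"
    using G s by (subst Bochner_Integration.integral_add)
      (auto simp: M.prob_space[unfolded sp] sp M.emeasure_finite less_top[symmetric])
  finally have 1: "(\<integral>y. q y \<partial>M) \<le> c + \<delta> / 2"
    using bad by simp
  have "c - measure N (- G) = (\<integral>y. c - indicator (- G) y \<partial>N)"
    using G s by (subst Bochner_Integration.integral_diff)
      (auto simp: N.prob_space[unfolded sp] sp N.emeasure_finite less_top[symmetric])
  also have "\<dots> \<le> (\<integral>y. e * q y \<partial>N)"
  proof (intro integral_mono integrable_mult_right int)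
    show "integrable N (\<lambda>y. c - indicator (- G) y)"
      by (intro Bochner_Integration.integrable_diff integrable_real_indicator) (auto simp: s N.emeasure_finite less_top[symmetric])
    show "c - indicator (- G) y \<le> e * q y" for y
    proof (cases "y \<in> G")
      \<comment> \<open>Here \<open>c \<le> 1\<close> makes the left side nonpositive, so the bad
        set of \<open>N\<close> costs its measure without the factor \<open>e\<close>.\<close>
      case False
      have "0 \<le> e * q y" using e q01(1) by simp
      with False c01 show ?thesis by simp
    qed (simp add: lower)
  qed
  finally have "c \<le> e * (\<integral>y. q y \<partial>N) + \<delta> / 2"
    using bad by simp
  with 1 show ?thesis by simp
qed

section \<open>The log-ratio and its threshold\<close>

lemma borel_measurable_log_ratio:
  assumes "p 0 \<in> borel_measurable borel" "p 1 \<in> borel_measurable borel"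
  shows "log_ratio p \<in> borel_measurable borel"
proof -
  have zeros: "{y. f y = 0} \<in> sets borel" if [measurable]: "f \<in> borel_measurable borel"
    for f :: "real \<Rightarrow> real"
    by measurable
  \<comment> \<open>Division and \<open>ln\<close> are total, so this branch is measurable on the
    whole line, including the points where another branch applies.\<close>
  have ln: "(\<lambda>y. ereal (ln (p 1 y / p 0 y))) \<in> borel_measurable borel"
    using assms by (intro borel_measurable_ereal borel_measurable_ln borel_measurable_divide)
  show ?thesis
    unfolding log_ratio_def using zeros[OF assms(1)] zeros[OF assms(2)]
    by (intro measurable_If ln measurable_const) (auto simp: Collect_conj_eq)
qed

text \<open>
  The infimum defining the threshold need not be attained, but right-continuity of the tail
  probability preserves the bound with \<open>\<le>\<close> in place of \<open><\<close>.
\<close>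

lemma tail_threshold_le:
  assumes ne: "thresholds P p \<delta> \<noteq> {}" and h: "h \<in> {0,1}" and "prob_space (P h)"
    and s: "sets (P h) = sets borel" and [measurable]: "log_ratio p \<in> borel_measurable borel"
  shows "measure (P h) {y. ereal (threshold P p \<delta>) < 2 * \<bar>log_ratio p y\<bar>} \<le> \<delta> / 2"
proof -
  interpret prob_space "P h" by fact
  have sp: "space (P h) = UNIV" using s[THEN sets_eq_imp_space_eq] by simp
  define B where "B t = {y. ereal t < 2 * \<bar>log_ratio p y\<bar>}" for t
  have B: "B t \<in> sets (P h)" for t
    unfolding s B_def by measurable
  have B_anti: "B t \<subseteq> B t'" if "t' \<le> t" for t t'
    unfolding B_def using that by (auto intro: le_less_trans[of "ereal t'" "ereal t"])
  let ?A = "threshold P p \<delta>" and ?t = "\<lambda>n. threshold P p \<delta> + 1 / real (Suc n)"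
  \<comment> \<open>The infimum lies strictly below \<open>?t n\<close>, hence so does an element of
    the set, and tails shrink as the level grows.\<close>
  have small: "measure (P h) (B (?t n)) \<le> \<delta> / 2" for n
  proof -
    have "Inf (thresholds P p \<delta>) < ?t n" by (simp add: threshold_def)
    then obtain t where t: "t \<in> thresholds P p \<delta>" "t < ?t n"
      using cInf_lessD[OF ne] by blast
    have "measure (P h) (B (?t n)) \<le> measure (P h) (B t)"
      using t B by (intro finite_measure_mono B_anti) auto
    also have "\<dots> = measure (P h) {y \<in> space (P h). ereal t < 2 * \<bar>log_ratio p y\<bar>}"
      by (simp add: B_def sp)
    also have "\<dots> < \<delta> / 2"
      using t(1) h by (auto simp: thresholds_def)
    finally show ?thesis by simp
  qed
  have "(\<lambda>n. measure (P h) (B (?t n))) \<longlonglongrightarrow> measure (P h) (\<Union>n. B (?t n))"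
  proof (rule finite_Lim_measure_incseq)
    show "range (\<lambda>n. B (?t n)) \<subseteq> sets (P h)" using B by blast
    show "incseq (\<lambda>n. B (?t n))"
      by (intro incseq_SucI B_anti add_left_mono divide_left_mono) simp_all
  qed
  \<comment> \<open>A strict inequality at level \<open>?A\<close> leaves room for some level
    \<open>?t n\<close> above it.\<close>
  moreover have "(\<Union>n. B (?t n)) = B ?A"
  proof
    show "(\<Union>n. B (?t n)) \<subseteq> B ?A"
      by (intro UN_least B_anti) simp
    show "B ?A \<subseteq> (\<Union>n. B (?t n))"
    proof
      fix y assume "y \<in> B ?A"
      then have "ereal ?A < 2 * \<bar>log_ratio p y\<bar>" by (simp add: B_def)
      then obtain r where r: "ereal ?A < ereal r" "ereal r < 2 * \<bar>log_ratio p y\<bar>"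
        using ereal_dense2[of "ereal ?A"] by metis
      from r(1) have "0 < r - ?A" by simp
      then obtain n where "1 / real (Suc n) < r - ?A"
        by (rule nat_approx_posE)
      then have "ereal (?t n) < ereal r" by simp
      from less_trans[OF this r(2)] have "y \<in> B (?t n)" unfolding B_def by (rule CollectI)
      then show "y \<in> (\<Union>n. B (?t n))" by blast
    qed
  qed
  ultimately have "(\<lambda>n. measure (P h) (B (?t n))) \<longlonglongrightarrow> measure (P h) (B ?A)" by simp
  then have "measure (P h) (B ?A) \<le> \<delta> / 2"
    by (rule LIMSEQ_le_const2) (use small in blast)
  then show ?thesis by (simp only: B_def)
qed

lemma threshold_nonneg: "thresholds P p \<delta> \<noteq> {} \<Longrightarrow> 0 \<le> threshold P p \<delta>"
  unfolding threshold_def by (rule cInf_greatest) (auto simp: thresholds_def)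

section \<open>The algorithm on databases differing in one entry\<close>

text \<open>Separates what the other entries fix from the contribution of \<open>y\<close>, which is
  common to all \<open>k \<le> j\<close> and absent from the later suffix sums.\<close>

lemma log_lik_fun_upd:
  assumes "j \<in> {1..n}"
  shows "log_lik p n (x(j := y)) k = (\<Sum>m\<in>{k..n} - {j}. log_ratio p (x m)) + (if k \<le> j then log_ratio p y else 0)"
proof -
  have eq: "(\<Sum>m\<in>{k..n} - {j}. log_ratio p ((x(j := y)) m)) = (\<Sum>m\<in>{k..n} - {j}. log_ratio p (x m))"
    by (intro sum.cong) auto
  show ?thesis
  proof (cases "k \<le> j")
    case True
    then show ?thesis
      using assms eq sum.remove[of "{k..n}" j "\<lambda>m. log_ratio p ((x(j := y)) m)"]
      by (simp add: log_lik_def add.commute)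
  next
    case False
    then have "{k..n} - {j} = {k..n}" by auto
    with False eq show ?thesis by (simp add: log_lik_def)
  qed
qed

lemma OfflinePCPD_maximisers:
  "OfflinePCPD tie x P p \<epsilon> \<delta> n =
    distr (\<Pi>\<^sub>M k\<in>{1..n}. Lap (threshold P p \<delta> / \<epsilon>)) (count_space UNIV)
      (\<lambda>Z. tie (maximisers {1..n} (\<lambda>k. log_lik p n x k + ereal (Z k))))"
  by (simp add: OfflinePCPD_def maximisers_def)

text \<open>Makes the algorithm a kernel in the exchanged entry, so that its output can be averaged
  over that entry; the scores are jointly measurable in entry and noise.\<close>

lemma measurable_OfflinePCPD:
  assumes lr [measurable]: "log_ratio p \<in> borel_measurable borel" and A: "0 \<le> threshold P p \<delta> / \<epsilon>"
  shows "(\<lambda>y. OfflinePCPD tie (x(j := y)) P p \<epsilon> \<delta> n) \<in> measurable borel (subprob_algebra (count_space UNIV))"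
  unfolding OfflinePCPD_maximisers
proof (rule measurable_distr2)
  let ?M = "\<Pi>\<^sub>M k\<in>{1..n}. Lap (threshold P p \<delta> / \<epsilon>)"
  have "prob_space ?M" by (intro prob_space_PiM prob_space_Lap A)
  then show "(\<lambda>y. ?M) \<in> measurable borel (subprob_algebra ?M)"
    by (intro measurable_const) (simp add: space_subprob_algebra prob_space_imp_subprob_space)
  have [measurable]: "(\<lambda>y. log_ratio p ((x(j := y)) m)) \<in> borel_measurable borel" for m
    by (cases "m = j") simp_all
  have [measurable]: "(\<lambda>y. log_lik p n (x(j := y)) k) \<in> borel_measurable borel" for k
    unfolding log_lik_def by measurable
  show "(\<lambda>(y, Z). tie (maximisers {1..n} (\<lambda>k. log_lik p n (x(j := y)) k + ereal (Z k))))
      \<in> measurable (borel \<Otimes>\<^sub>M ?M) (count_space UNIV)"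
    unfolding case_prod_beta by (intro measurable_tie_maximisers) measurable
qed

lemma prob_space_OfflinePCPD:
  assumes A: "0 \<le> threshold P p \<delta> / \<epsilon>"
  shows "prob_space (OfflinePCPD tie x P p \<epsilon> \<delta> n)"
proof -
  let ?M = "\<Pi>\<^sub>M k\<in>{1..n}. Lap (threshold P p \<delta> / \<epsilon>)"
  interpret prob_space ?M by (intro prob_space_PiM prob_space_Lap A)
  show ?thesis
    unfolding OfflinePCPD_maximisers
    by (intro prob_space_distr measurable_tie_maximisers) measurable
qed

text \<open>Good values have finite log-ratios of size at most half the threshold. The bound is
  proved for each single output and summed over \<open>S\<close>, which is harmless as it has no
  additive term.\<close>

lemma measure_OfflinePCPD_good_le:
  assumes \<epsilon>: "\<epsilon> > 0" and A: "0 \<le> threshold P p \<delta>"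
    and tie: "\<And>K. K \<noteq> {} \<Longrightarrow> K \<subseteq> {1..n} \<Longrightarrow> tie K \<in> K"
    and j: "j \<in> {1..n}" and S: "S \<subseteq> {1..n}"
    and y: "2 * \<bar>log_ratio p y\<bar> \<le> ereal (threshold P p \<delta>)"
    and y': "2 * \<bar>log_ratio p y'\<bar> \<le> ereal (threshold P p \<delta>)"
  shows "measure (OfflinePCPD tie (x(j := y)) P p \<epsilon> \<delta> n) S
    \<le> exp \<epsilon> * measure (OfflinePCPD tie (x(j := y')) P p \<epsilon> \<delta> n) S"
proof -
  let ?A = "threshold P p \<delta>" and ?I = "{1..n}"
  let ?Q = "\<lambda>y. OfflinePCPD tie (x(j := y)) P p \<epsilon> \<delta> n"
  define b where "b = ?A / \<epsilon>"
  define M where "M = (\<Pi>\<^sub>M k\<in>?I. Lap b)"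
  have b0: "0 \<le> b" using A \<epsilon> by (simp add: b_def)
  obtain r where r: "log_ratio p y = ereal r" "2 * \<bar>r\<bar> \<le> ?A"
    using y by (cases "log_ratio p y") auto
  obtain r' where r': "log_ratio p y' = ereal r'" "2 * \<bar>r'\<bar> \<le> ?A"
    using y' by (cases "log_ratio p y'") auto
  define u where "u k = (\<Sum>m\<in>{k..n} - {j}. log_ratio p (x m))" for k
  define g where "g t k = (if k \<le> j then t else 0)" for t :: real and k
  \<comment> \<open>A real shift \<open>t\<close> can be moved from the score to the noise even if
    \<open>u k\<close> is infinite.\<close>
  have ll: "log_lik p n (x(j := z)) k + ereal a = u k + ereal (g t k + a)"
    if "log_ratio p z = ereal t" for z t k a
    unfolding log_lik_fun_upd[OF j] that g_def u_def[symmetric]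
    by (cases "u k") auto
  have Q: "?Q z = distr M (count_space UNIV) (\<lambda>Z. tie (maximisers ?I (\<lambda>k. u k + ereal (g t k + Z k))))"
    if "log_ratio p z = ereal t" for z t
    unfolding OfflinePCPD_maximisers ll[OF that] M_def b_def ..
  have pQ: "prob_space (?Q z)" for z
    using b0 by (intro prob_space_OfflinePCPD) (simp add: b_def)
  have le: "measure (?Q y) S \<le> exp \<epsilon> * measure (?Q y') S" if "?Q y = ?Q y'"
  proof -
    have "1 * measure (?Q y') S \<le> exp \<epsilon> * measure (?Q y') S"
      using \<epsilon> by (intro mult_right_mono) auto
    with that show ?thesis by simp
  qed
  \<comment> \<open>Point-mass noise, which has no density to shift, and infinite scores that settle
    the maximisers are split off; in both cases the two output distributions coincide.\<close>
  consider "b = 0" | "(\<exists>k\<in>?I. u k = \<infinity>) \<or> (\<forall>k\<in>?I. u k = -\<infinity>)"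
    | "b > 0" "\<And>k. k \<in> ?I \<Longrightarrow> u k \<noteq> \<infinity>" "\<exists>k\<in>?I. u k \<noteq> -\<infinity>"
    using b0 by fastforce
  then show ?thesis
  proof cases
    case 1
    \<comment> \<open>A zero threshold forces both good log-ratios to be 0.\<close>
    with \<epsilon> have "?A = 0" by (simp add: b_def)
    with r r' have "r = r'" by simp
    then show ?thesis by (intro le) (simp only: Q[OF r(1)] Q[OF r'(1)])
  next
    case 2
    have "maximisers ?I (\<lambda>k. u k + ereal (g r k + Z k)) = maximisers ?I (\<lambda>k. u k + ereal (g r' k + Z k))" for Z
      by (rule maximisers_degenerate[OF 2])
    then show ?thesis
      by (intro le) (simp only: Q[OF r(1)] Q[OF r'(1)])
  next
    case 3
    have meas: "(\<lambda>Z. tie (maximisers ?I (\<lambda>k. u k + ereal (g t k + Z k)))) \<in> measurable M (count_space UNIV)" for t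
      unfolding M_def by (intro measurable_tie_maximisers) measurable
    have em: "emeasure (?Q z) {k} = emeasure M {Z\<in>space M. tie (maximisers ?I (\<lambda>l. u l + ereal (g t l + Z l))) = k}"
      if "log_ratio p z = ereal t" for z t k
      unfolding Q[OF that] by (subst emeasure_distr[OF meas]) (auto intro!: arg_cong[where f = "emeasure M"])
    have "measure (?Q y) {k} \<le> exp \<epsilon> * measure (?Q y') {k}" if k: "k \<in> ?I" for k
    proof -
      interpret Q: prob_space "?Q y" by (rule pQ)
      interpret Q': prob_space "?Q y'" by (rule pQ)
      have "emeasure (?Q y) {k} \<le> ennreal (exp (?A / b)) * emeasure (?Q y') {k}"
        unfolding em[OF r(1)] em[OF r'(1)] M_def
      proof (rule noisy_maximiser_shift_le[OF 3(1) finite_atLeastAtMost k tie 3(2,3)])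
        \<comment> \<open>A difference remains only if exactly one of \<open>k\<close> and
          \<open>l\<close> is at most \<open>j\<close>, and it is then at most
          \<open>\<bar>r\<bar> + \<bar>r'\<bar>\<close>; the factor 2 in the threshold pays for the
          two terms.\<close>
        fix l
        show "g r k - g r l - (g r' k - g r' l) \<le> ?A"
          using r(2) r'(2) by (auto simp: g_def)
      qed
      also have "?A / b = \<epsilon>" using 3(1) \<epsilon> by (auto simp: b_def)
      finally show ?thesis
        unfolding Q.emeasure_eq_measure Q'.emeasure_eq_measure
        by (subst (asm) ennreal_mult'[symmetric]) simp_all
    qed
    then have "(\<Sum>k\<in>S. measure (?Q y) {k}) \<le> (\<Sum>k\<in>S. exp \<epsilon> * measure (?Q y') {k})"
      using S by (intro sum_mono) auto
    moreover have "measure (?Q z) S = (\<Sum>k\<in>S. measure (?Q z) {k})" for z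
    proof -
      interpret Q: prob_space "?Q z" by (rule pQ)
      show ?thesis
        using finite_subset[OF S] by (intro Q.finite_measure_eq_sum_singleton) (simp_all add: OfflinePCPD_def)
    qed
    ultimately show ?thesis by (simp add: sum_distrib_left)
  qed
qed

section \<open>Averaging over the random entry\<close>

theorem theorem6:
  fixes P :: "nat \<Rightarrow> real measure" and p :: "nat \<Rightarrow> real \<Rightarrow> real" and \<mu> :: "real measure"
    and \<epsilon> \<delta> :: real and n j i i' :: nat and x :: "nat \<Rightarrow> real"
    and tie :: "nat set \<Rightarrow> nat" and S :: "nat set"
  assumes "\<epsilon> > 0" and "\<delta> > 0"
    and "sets \<mu> = sets borel"
    and "\<And>h. h \<in> {0,1} \<Longrightarrow> prob_space (P h)"
    and "\<And>h. h \<in> {0,1} \<Longrightarrow> p h \<in> borel_measurable borel"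
    and "\<And>h y. h \<in> {0,1} \<Longrightarrow> 0 \<le> p h y"
    and "\<And>h. h \<in> {0,1} \<Longrightarrow> P h = density \<mu> (\<lambda>y. ennreal (p h y))"
    and "thresholds P p \<delta> \<noteq> {}"
    and "\<And>K. K \<noteq> {} \<Longrightarrow> K \<subseteq> {1..n} \<Longrightarrow> tie K \<in> K"
    and "j \<in> {1..n}" and "i \<in> {0,1}" and "i' \<in> {0,1}"
    and "S \<subseteq> {1..n}"
  shows "measure (P i \<bind> (\<lambda>y. OfflinePCPD tie (x(j := y)) P p \<epsilon> \<delta> n)) S
    \<le> exp \<epsilon> * measure (P i' \<bind> (\<lambda>y. OfflinePCPD tie (x(j := y)) P p \<epsilon> \<delta> n)) S + \<delta>"
proof -
  let ?A = "threshold P p \<delta>"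
  let ?Q = "\<lambda>y. OfflinePCPD tie (x(j := y)) P p \<epsilon> \<delta> n"
  have sets_P: "sets (P h) = sets borel" if "h \<in> {0,1}" for h
    using assms(3,7) that by simp
  have lr [measurable]: "log_ratio p \<in> borel_measurable borel"
    using assms(5) by (intro borel_measurable_log_ratio) auto
  have A: "0 \<le> ?A" by (rule threshold_nonneg) fact
  then have A': "0 \<le> ?A / \<epsilon>" using assms(1) by simp
  have Q [measurable]: "?Q \<in> measurable borel (subprob_algebra (count_space UNIV))"
    by (rule measurable_OfflinePCPD[OF lr A'])
  have bind: "measure (P h \<bind> ?Q) S = (\<integral>y. measure (?Q y) S \<partial>P h)" if h: "h \<in> {0,1}" for h
  proof -
    interpret prob_space "P h" using assms(4) h .
    have "?Q \<in> measurable (P h) (subprob_algebra (count_space UNIV))"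
      using Q by (simp add: sets_P[OF h] cong: measurable_cong_sets)
    then show ?thesis by (rule measure_bind) simp
  qed
  \<comment> \<open>The non-strict inequality makes \<open>- G\<close> exactly the strict tail that
    is bounded at the threshold; it also excludes infinite log-ratios.\<close>
  define G where "G = {y. 2 * \<bar>log_ratio p y\<bar> \<le> ereal ?A}"
  have "(\<integral>y. measure (?Q y) S \<partial>P i) \<le> exp \<epsilon> * (\<integral>y. measure (?Q y) S \<partial>P i') + \<delta>"
  proof (rule integral_le_if_ratio_bounded_on_good)
    show "(\<lambda>y. measure (?Q y) S) \<in> borel_measurable borel"
      by (rule measurable_compose[OF Q measurable_measure_subprob_algebra]) simp
    show "measure (?Q y) S \<le> 1" for y
      using prob_space.prob_le_1[OF prob_space_OfflinePCPD[OF A']] .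
    show "G \<in> sets borel" unfolding G_def by measurable
    have "- G = {y. ereal ?A < 2 * \<bar>log_ratio p y\<bar>}"
      by (auto simp: G_def not_le)
    then show "measure (P i) (- G) \<le> \<delta> / 2" "measure (P i') (- G) \<le> \<delta> / 2"
      using tail_threshold_le[OF assms(8) _ assms(4) sets_P lr] assms(11,12) by simp_all
    show "measure (?Q y) S \<le> exp \<epsilon> * measure (?Q y') S" if "y \<in> G" "y' \<in> G" for y y'
      using that unfolding G_def mem_Collect_eq
      by (intro measure_OfflinePCPD_good_le[OF assms(1) A _ assms(10,13)] assms(9))
  qed (simp_all add: assms(4)[OF assms(11)] assms(4)[OF assms(12)]
      sets_P[OF assms(11)] sets_P[OF assms(12)])
  then show ?thesis
    unfolding bind[OF assms(11)] bind[OF assms(12)] .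
qed

end
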